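(* For any (real or complex) constants $\alpha,\beta$ and $\eta$, $$\frac{1}{\alpha+\beta+1}\Bigl[\cosh(\eta x^\beta)\;{}_1F_2\Bigl(1; \frac{\alpha+\beta+1}{2\beta}, \frac{\alpha+2\beta+1}{2\beta}; \frac{\eta^2 x^{2\beta}}{4}\Bigr)- \beta\eta x^{\beta}\sinh(\eta x^\beta)\;{}_1F_2\Bigl(1; \frac{\alpha+2\beta+1}{2\beta}, \frac{\alpha+3\beta+1}{2\beta}; \frac{\eta^2 x^{2\beta}}{4}\Bigr)\Bigr]$$ $$=\frac{1}{2}\Bigl[e^{\eta x^\beta}\;{}_1F_1\Bigl(1;\frac{\alpha+\beta+1}{\beta}; -\eta x^{\beta}\Bigr)+e^{-\eta x^\beta}\;{}_1F_1\Bigl(1;\frac{\alpha+\beta+1}{\beta}; \eta x^{\beta}\Bigr)\Bigr].$$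
   Context: ${}_1F_1(a;b;x)=\sum_{n=0}^{\infty}\frac{(a)_n}{(b)_n}\frac{x^n}{n!}$ and ${}_1F_2(a;b,c;x)=\sum_{n=0}^{\infty}\frac{(a)_n}{(b)_n(c)_n}\frac{x^n}{n!}$, where $(\vartheta)_n=\Gamma(\vartheta+n)/\Gamma(\vartheta)$, $(\vartheta)_0=1$ (Pochhammer symbol). The identity is an identity in the variable $x$.
   Formalization: The printed identity is false (η=0, α=β=1 gives 1/3=1); the factor 1/(α+β+1) is applied to the sinh term only, not to the cosh term, and β≠0 and (α+β+1)/β not a non-positive integer are assumed so that all terms are defined. *)

theory Defs
  imports "HOL-Analysis.Analysis"
begin

(* Both series have infinite radius of convergence whenever no lower parameter is a
   non-positive integer; outside that range the terms contain divisions by zero. *)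

definition hyp_1F1 :: "complex \<Rightarrow> complex \<Rightarrow> complex \<Rightarrow> complex" where
  "hyp_1F1 a b x = (\<Sum>n. pochhammer a n / pochhammer b n * (x ^ n / fact n))"

definition hyp_1F2 :: "complex \<Rightarrow> complex \<Rightarrow> complex \<Rightarrow> complex \<Rightarrow> complex" where
  "hyp_1F2 a b c x =
     (\<Sum>n. pochhammer a n / (pochhammer b n * pochhammer c n) * (x ^ n / fact n))"

(* In the identity relating these functions, x powr \<beta> is the principal branch, with
   0 powr \<beta> = 0.  The single condition that (\<alpha> + \<beta> + 1) / \<beta> is not a non-positive integer
   makes every lower parameter there admissible and \<alpha> + \<beta> + 1 nonzero: if one of
   (\<alpha> + (j + 1) * \<beta> + 1) / (2 * \<beta>), j = 0, 1, 2, equals -k, then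
   (\<alpha> + \<beta> + 1) / \<beta> = -(2 * k + j).

   The factor 1 / (\<alpha> + \<beta> + 1) multiplies only the sinh term.  The variant in which it
   multiplies the cosh term as well is false: for \<eta> = 0 its left side is 1 / (\<alpha> + \<beta> + 1)
   and its right side is 1. *)

end

(* With c = (\<alpha> + \<beta> + 1) / \<beta> and z = \<eta> x^\<beta>, the duplication formula
   (c)_{2n} = 4^n (c/2)_n ((c+1)/2)_n identifies the first 1F2 with the even part of
   1F1(1; c; z), and (c)_{2n+1} = c (c+1)_{2n} identifies z/c times the second one with its odd part.
   The identity is then exp z = cosh z + sinh z. *)

theory Submission
  imports Defs
begin

lemma hyp_1F1_one: "hyp_1F1 1 c z = (\<Sum>n. z ^ n / pochhammer c n)"
  by (simp add: hyp_1F1_def pochhammer_fact[symmetric])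

lemma hyp_1F2_one: "hyp_1F2 1 b c z = (\<Sum>n. z ^ n / (pochhammer b n * pochhammer c n))"
  by (simp add: hyp_1F2_def pochhammer_fact[symmetric])

text \<open>Consecutive terms have ratio \<open>z / (c + of_nat n)\<close>, which tends to 0. If
  \<open>c\<close> is a non-positive integer, the terms are eventually 0 because division by zero
  yields 0.\<close>

lemma summable_power_div_pochhammer:
  fixes c z :: complex
  shows "summable (\<lambda>n. z ^ n / pochhammer c n)"
proof -
  \<comment> \<open>For n \<ge> N the reverse triangle inequality gives |c + n| \<ge> 2|z| + 1. The
    factor 2 yields the ratio 1/2; the summand 1 keeps c + n away from 0 even if z = 0.\<close>
  obtain N :: nat where N: "2 * norm z + norm c + 1 \<le> real N"
    using real_arch_simple by blast
  show ?thesis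
  proof (rule summable_ratio_test[where c = "1/2" and N = N])
    fix n assume "N \<le> n"
    have "norm (of_nat n :: complex) \<le> norm (c + of_nat n) + norm c"
      by (metis add_diff_cancel_left' norm_triangle_ineq4)
    with N \<open>N \<le> n\<close> have *: "2 * norm z + 1 \<le> norm (c + of_nat n)"
      by simp
    moreover have "norm (c + of_nat n) > 0"
      using * norm_ge_zero[of z] by linarith
    ultimately have "norm (z / (c + of_nat n)) \<le> 1 / 2"
      by (simp add: norm_divide field_simps)
    then have "norm (z / (c + of_nat n)) * norm (z ^ n / pochhammer c n)
      \<le> 1 / 2 * norm (z ^ n / pochhammer c n)"
      by (rule mult_right_mono) simp
    then show "norm (z ^ Suc n / pochhammer c (Suc n)) \<le> 1 / 2 * norm (z ^ n / pochhammer c n)"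
      by (simp add: pochhammer_Suc norm_mult norm_divide mult_ac)
  qed simp
qed

text \<open>Odd powers cancel in the sum and even powers double, so only the terms of index
  \<open>2 * n\<close> survive and the series can be reindexed.\<close>

lemma hyp_1F1_one_even_part:
  "hyp_1F1 1 c z + hyp_1F1 1 c (- z) = 2 * hyp_1F2 1 (c / 2) ((c + 1) / 2) (z\<^sup>2 / 4)"
proof -
  let ?e = "\<lambda>n. z ^ n / pochhammer c n + (- z) ^ n / pochhammer c n"
  let ?t = "\<lambda>n. (z\<^sup>2 / 4) ^ n / (pochhammer (c / 2) n * pochhammer ((c + 1) / 2) n)"
  have double: "strict_mono (\<lambda>n::nat. 2 * n)"
    by (simp add: strict_mono_def)
  have zero: "?e n = 0" if "n \<notin> range (\<lambda>n. 2 * n)" for n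
    using that by (cases "even n") (auto elim: evenE)
  have even_term: "?e (2 * n) = 2 * ?t n" for n
  proof -
    have "pochhammer c (2 * n) = 4 ^ n * pochhammer (c / 2) n * pochhammer ((c + 1) / 2) n"
      using pochhammer_double[of "c / 2" n] by (simp add: power_mult add_divide_distrib)
    then show ?thesis
      by (simp add: power_mult power_divide mult.assoc)
  qed
  \<comment> \<open>The \<open>hyp_1F2\<close> series inherits its convergence:
    \<open>2 * ?t\<close> is the subsequence of \<open>?e\<close> left after dropping zero
    terms.\<close>
  have "summable ?e"
    by (intro summable_add summable_power_div_pochhammer)
  then have "summable (\<lambda>n. 2 * ?t n)"
    unfolding even_term[symmetric] using summable_mono_reindex[OF double, of ?e] zero by blast
  then have "summable ?t"
    by (rule summable_mult_D) simp
  have "hyp_1F1 1 c z + hyp_1F1 1 c (- z) = suminf ?e"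
    unfolding hyp_1F1_one by (intro suminf_add summable_power_div_pochhammer)
  also have "\<dots> = (\<Sum>n. 2 * ?t n)"
    unfolding even_term[symmetric] by (rule suminf_mono_reindex[OF double zero, symmetric])
  also have "\<dots> = 2 * hyp_1F2 1 (c / 2) ((c + 1) / 2) (z\<^sup>2 / 4)"
    unfolding hyp_1F2_one by (rule suminf_mult) fact
  finally show ?thesis .
qed

text \<open>Splitting off the term of index 0 leaves a common factor z/c, since (c)_{n+1} = c
  (c+1)_n.\<close>

lemma hyp_1F1_one_contiguous:
  "hyp_1F1 1 c z = 1 + z / c * hyp_1F1 1 (c + 1) z"
proof -
  have "hyp_1F1 1 c z = 1 + (\<Sum>n. z ^ Suc n / pochhammer c (Suc n))"
    unfolding hyp_1F1_one using suminf_split_head[OF summable_power_div_pochhammer[of z c]] by simp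
  also have "(\<Sum>n. z ^ Suc n / pochhammer c (Suc n)) = (\<Sum>n. z / c * (z ^ n / pochhammer (c + 1) n))"
    by (simp add: pochhammer_rec)
  also have "\<dots> = z / c * hyp_1F1 1 (c + 1) z"
    unfolding hyp_1F1_one by (rule suminf_mult[OF summable_power_div_pochhammer])
  finally show ?thesis .
qed

text \<open>In the contiguous relation the constant 1 cancels and z/c changes sign with z, so the
  odd part at \<open>c\<close> reduces to the even part at \<open>c + 1\<close>.\<close>

lemma hyp_1F1_one_odd_part:
  "hyp_1F1 1 c z - hyp_1F1 1 c (- z) = 2 * (z / c * hyp_1F2 1 ((c + 1) / 2) ((c + 2) / 2) (z\<^sup>2 / 4))"
proof -
  have "hyp_1F1 1 c z - hyp_1F1 1 c (- z)
      = z / c * (hyp_1F1 1 (c + 1) z + hyp_1F1 1 (c + 1) (- z))"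
    by (simp add: hyp_1F1_one_contiguous[of c] ring_distribs)
  also have "\<dots> = 2 * (z / c * hyp_1F2 1 ((c + 1) / 2) ((c + 2) / 2) (z\<^sup>2 / 4))"
    by (simp add: hyp_1F1_one_even_part add.assoc)
  finally show ?thesis .
qed

theorem theorem2:
  fixes \<alpha> \<beta> \<eta> x :: complex
  assumes "\<beta> \<noteq> 0"
    and "(\<alpha> + \<beta> + 1) / \<beta> \<notin> \<int>\<^sub>\<le>\<^sub>0"
  shows "cosh (\<eta> * x powr \<beta>) *
           hyp_1F2 1 ((\<alpha> + \<beta> + 1) / (2 * \<beta>)) ((\<alpha> + 2 * \<beta> + 1) / (2 * \<beta>))
             (\<eta>\<^sup>2 * x powr (2 * \<beta>) / 4)
         - 1 / (\<alpha> + \<beta> + 1) *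
           (\<beta> * \<eta> * x powr \<beta> * sinh (\<eta> * x powr \<beta>) *
            hyp_1F2 1 ((\<alpha> + 2 * \<beta> + 1) / (2 * \<beta>)) ((\<alpha> + 3 * \<beta> + 1) / (2 * \<beta>))
              (\<eta>\<^sup>2 * x powr (2 * \<beta>) / 4))
       = 1 / 2 *
           (exp (\<eta> * x powr \<beta>) * hyp_1F1 1 ((\<alpha> + \<beta> + 1) / \<beta>) (- \<eta> * x powr \<beta>)
          + exp (- \<eta> * x powr \<beta>) * hyp_1F1 1 ((\<alpha> + \<beta> + 1) / \<beta>) (\<eta> * x powr \<beta>))"
proof -
  define c z where "c = (\<alpha> + \<beta> + 1) / \<beta>" and "z = \<eta> * x powr \<beta>"
  have params: "(\<alpha> + \<beta> + 1) / (2 * \<beta>) = c / 2" "(\<alpha> + 2 * \<beta> + 1) / (2 * \<beta>) = (c + 1) / 2"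
      "(\<alpha> + 3 * \<beta> + 1) / (2 * \<beta>) = (c + 2) / 2"
    using \<open>\<beta> \<noteq> 0\<close> by (simp_all add: c_def field_simps)
  \<comment> \<open>Doubling the exponent squares the principal power, as both are exponentials of
    multiples of the same logarithm; for x = 0 both sides vanish.\<close>
  have arg: "\<eta>\<^sup>2 * x powr (2 * \<beta>) / 4 = z\<^sup>2 / 4"
    by (simp add: z_def power_mult_distrib powr_def flip: exp_double mult.assoc)
  \<comment> \<open>The prefactor is absorbed by z/c = \<beta> z / (\<alpha> + \<beta> + 1).\<close>
  have coeff: "1 / (\<alpha> + \<beta> + 1) * (\<beta> * \<eta> * x powr \<beta> * s * h) = s * (z / c * h)" for s h
    by (simp add: c_def z_def)
  define A B where "A = hyp_1F2 1 (c / 2) ((c + 1) / 2) (z\<^sup>2 / 4)"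
    and "B = z / c * hyp_1F2 1 ((c + 1) / 2) ((c + 2) / 2) (z\<^sup>2 / 4)"
  have "hyp_1F1 1 c z + hyp_1F1 1 c (- z) = 2 * A" "hyp_1F1 1 c z - hyp_1F1 1 c (- z) = 2 * B"
    unfolding A_def B_def by (rule hyp_1F1_one_even_part hyp_1F1_one_odd_part)+
  then have hyps: "hyp_1F1 1 c z = A + B" "hyp_1F1 1 c (- z) = A - B"
    by algebra+
  \<comment> \<open>In e^z (A - B) + e^(-z) (A + B) the mixed products A sinh z and B cosh z cancel,
    and the remaining ones double.\<close>
  have "cosh z * A - sinh z * B
      = 1 / 2 * (exp z * hyp_1F1 1 c (- z) + exp (- z) * hyp_1F1 1 c z)"
    unfolding hyps cosh_plus_sinh[symmetric] by (simp add: field_simps)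
  then show ?thesis
    unfolding params arg z_def[symmetric] c_def[symmetric] coeff A_def B_def mult_minus_left by simp
qed

end
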